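(* Let $A$ and $B$ be finite sets of UTVPI constraints with integer constants, such that $A\wedge B$ is satisfiable over $\mathbb Q$ but unsatisfiable over $\mathbb Z$. Let $A',B'$ be their difference-logic encodings and let $C$ be a cycle of total weight $0$ in the constraint graph $G(A'\wedge B')$ (each edge labelled as coming from $A'$ or from $B'$; write $C_A$, $C_B$ for the $A'$- and $B'$-edges of $C$) that contains, each exactly once, the two vertices $x_i^+$ and $x_i^-$ of some variable $x_i$, such that the weight of the path $\pi$ from $x_i^-$ to $x_i^+$ along $C$ is odd, say $2k+1$. Suppose $x_i$ occurs in $A$ but not in $B$, and that all edges of $\pi$ belong to $C_A$. Let $\overline C$ be the cycle obtained from $C$ by replacing $\pi$ with the single edge $x_i^-\xrightarrow{2k} x_i^+$ (i.e. the constraint $(0\le x_i^+-x_i^-+2k)$), labelled as an $A'$-edge. Let $I'$ be the difference-logic interpolant computed from $\overline C$, namely $I'=\bot$ if all edges of $\overline C$ are $A'$-edges, and otherwise the conjunction of the summary constraints of the maximal $A'$-paths of $\overline C$; and let $I=\Upsilon(I')$. Then $I$ is an interpolant for $(A,B)$ over the integers.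
   Context: A UTVPI constraint is $(0\le a x + b y + k)$ with $a,b\in\{-1,0,1\}$. For each variable $x$ there are difference-logic variables $x^+,x^-$, with $\Upsilon(x^+)=x$, $\Upsilon(x^-)=-x$; write $v(x)=x^+$, $v(-x)=x^-$ for signed variables. Encoding: $(0\le s_1+s_2+k)$ with $s_1,s_2$ signed occurrences of distinct variables becomes $(0\le v(s_1)-v(-s_2)+k)$ and $(0\le v(s_2)-v(-s_1)+k)$; $(0\le s+k)$ becomes $(0\le v(s)-v(-s)+2k)$. $\Upsilon(0\le v-u+k)=(0\le\Upsilon(v)-\Upsilon(u)+k)$, extended to conjunctions, with $\Upsilon(\bot)=\bot$. The graph has an edge $u\xrightarrow{c}v$ per constraint $(0\le v-u+c)$. A maximal $A'$-path of a cycle is a maximal path $u_1\xrightarrow{c_1}\cdots\xrightarrow{c_{n-1}}u_n$ of consecutive $A'$-edges preceded and followed in the cycle by $B'$-edges; its summary constraint is $(0\le u_n-u_1+\sum c_j)$. An interpolant for $(A,B)$ over the integers is a formula $I$ with $A\models I$ and $I\wedge B$ unsatisfiable (variables ranging over $\mathbb Z$), and every variable of $I$ occurring in both $A$ and $B$. *)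

theory Defs
  imports Complex_Main "Graph_Theory.Arc_Walk"
begin

section \<open>Linear constraints in two terms and UTVPI constraints\<close>

text \<open>\<open>Lin a x b y k\<close> stands for the constraint \<open>0 \<le> a x + b y + k\<close>.\<close>

datatype 'v lin = Lin int 'v int 'v int

fun holds :: "('v \<Rightarrow> 'a::linordered_idom) \<Rightarrow> 'v lin \<Rightarrow> bool" where
  "holds \<sigma> (Lin a x b y k) \<longleftrightarrow> 0 \<le> of_int a * \<sigma> x + of_int b * \<sigma> y + of_int k"

text \<open>A variable with coefficient \<open>0\<close> does not occur. Cancellation is not performed:
  the variable \<open>x\<close> does occur in \<open>0 \<le> x - x + k\<close>.\<close>

fun vars_lin :: "'v lin \<Rightarrow> 'v set" where
  "vars_lin (Lin a x b y k) = (if a \<noteq> 0 then {x} else {}) \<union> (if b \<noteq> 0 then {y} else {})"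

fun utvpi :: "'v lin \<Rightarrow> bool" where
  "utvpi (Lin a x b y k) \<longleftrightarrow>
     a \<in> {-1, 0, 1} \<and> b \<in> {-1, 0, 1} \<and> (a \<noteq> 0 \<and> b \<noteq> 0 \<longrightarrow> x \<noteq> y)"

definition sat_all :: "('v \<Rightarrow> 'a::linordered_idom) \<Rightarrow> 'v lin set \<Rightarrow> bool" where
  "sat_all \<sigma> S \<longleftrightarrow> (\<forall>c\<in>S. holds \<sigma> c)"

definition vars_of :: "'v lin set \<Rightarrow> 'v set" where
  "vars_of S = (\<Union>c\<in>S. vars_lin c)"


section \<open>Signed variables and the difference-logic encoding\<close>

datatype 'v signed = Pos 'v | Neg 'v

fun negate :: "'v signed \<Rightarrow> 'v signed" where
  "negate (Pos x) = Neg x"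
| "negate (Neg x) = Pos x"

text \<open>The difference-logic variables \<open>x\<^sup>+\<close> and \<open>x\<^sup>-\<close>.\<close>

datatype 'v dlvar = Plus 'v | Minus 'v

text \<open>\<open>DL v u c\<close> stands for the constraint \<open>0 \<le> v - u + c\<close>, i.e. for an edge
  from \<open>u\<close> to \<open>v\<close> of weight \<open>c\<close>.\<close>

datatype 'v dl = DL (target: "'v dlvar") (source: "'v dlvar") (weight: int)

fun dlvar_of :: "'v signed \<Rightarrow> 'v dlvar" where
  "dlvar_of (Pos x) = Plus x"
| "dlvar_of (Neg x) = Minus x"

definition occs :: "int \<Rightarrow> 'v \<Rightarrow> 'v signed list" where
  "occs a x = (if a = 1 then [Pos x] else if a = -1 then [Neg x] else [])"

text \<open>Constraints \<open>0 \<le> k\<close> without variables have no difference-logic counterpart; they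
  contribute nothing (all those considered below are satisfiable, hence valid).\<close>

fun encode :: "'v lin \<Rightarrow> 'v dl set" where
  "encode (Lin a x b y k) =
     (case occs a x @ occs b y of
        [s1, s2] \<Rightarrow> {DL (dlvar_of s1) (dlvar_of (negate s2)) k,
                     DL (dlvar_of s2) (dlvar_of (negate s1)) k}
      | [s] \<Rightarrow> {DL (dlvar_of s) (dlvar_of (negate s)) (2 * k)}
      | _ \<Rightarrow> {})"

definition encode_all :: "'v lin set \<Rightarrow> 'v dl set" where
  "encode_all S = (\<Union>c\<in>S. encode c)"


section \<open>The labelled constraint graph\<close>

datatype label = LA | LB

text \<open>An edge is a constraint together with its origin; a constraint belonging to both
  encodings yields two parallel edges.\<close>

type_synonym 'v edge = "label \<times> 'v dl"

definition constraint_graph :: "'v dl set \<Rightarrow> 'v dl set \<Rightarrow> ('v dlvar, 'v edge) pre_digraph" where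
  "constraint_graph A' B' =
     \<lparr> verts = (\<Union>c\<in>A' \<union> B'. {source c, target c}),
       arcs = {LA} \<times> A' \<union> {LB} \<times> B',
       tail = \<lambda>e. source (snd e),
       head = \<lambda>e. target (snd e) \<rparr>"

abbreviation is_A :: "'v edge \<Rightarrow> bool" where
  "is_A e \<equiv> fst e = LA"

definition path_weight :: "'v edge list \<Rightarrow> int" where
  "path_weight p = (\<Sum>e\<leftarrow>p. weight (snd e))"


section \<open>Formulas and the translation back\<close>

datatype 'a formula = Bot | Conj "'a list"

fun formula_holds :: "('v \<Rightarrow> int) \<Rightarrow> 'v lin formula \<Rightarrow> bool" where
  "formula_holds \<sigma> Bot \<longleftrightarrow> False"
| "formula_holds \<sigma> (Conj cs) \<longleftrightarrow> (\<forall>c\<in>set cs. holds \<sigma> c)"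

fun formula_vars :: "'v lin formula \<Rightarrow> 'v set" where
  "formula_vars Bot = {}"
| "formula_vars (Conj cs) = (\<Union>c\<in>set cs. vars_lin c)"

text \<open>\<open>\<Upsilon>(x\<^sup>+) = 1 * x\<close> and \<open>\<Upsilon>(x\<^sup>-) = (-1) * x\<close> are given by a coefficient and a variable.\<close>

fun ups_var :: "'v dlvar \<Rightarrow> int \<times> 'v" where
  "ups_var (Plus x) = (1, x)"
| "ups_var (Minus x) = (-1, x)"

fun ups_constr :: "'v dl \<Rightarrow> 'v lin" where
  "ups_constr (DL v u k) =
     Lin (fst (ups_var v)) (snd (ups_var v)) (- fst (ups_var u)) (snd (ups_var u)) k"

fun ups :: "'v dl formula \<Rightarrow> 'v lin formula" where
  "ups Bot = Bot"
| "ups (Conj cs) = Conj (map ups_constr cs)"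


section \<open>Interpolants\<close>

text \<open>The maximal \<open>A'\<close>-paths of a cycle given by its cyclic list of edges: every position
  holding an \<open>A'\<close>-edge that is cyclically preceded by a \<open>B'\<close>-edge starts one, and it extends
  up to the next \<open>B'\<close>-edge.\<close>

definition max_A_paths :: "'v edge list \<Rightarrow> 'v edge list list" where
  "max_A_paths es =
     map (\<lambda>i. takeWhile is_A (rotate i es))
       (filter (\<lambda>i. is_A (hd (rotate i es)) \<and> \<not> is_A (last (rotate i es))) [0..<length es])"

lemma set_max_A_paths:
  "set (max_A_paths es) =
     {p. \<exists>n q. rotate n es = p @ q \<and> p \<noteq> [] \<and> q \<noteq> [] \<and>
           (\<forall>e\<in>set p. is_A e) \<and> \<not> is_A (hd q) \<and> \<not> is_A (last q)}" (is "_ = ?R")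
proof (intro equalityI subsetI)
  fix p assume "p \<in> set (max_A_paths es)"
  then obtain i where i: "i < length es" "is_A (hd (rotate i es))" "\<not> is_A (last (rotate i es))"
    and p: "p = takeWhile is_A (rotate i es)"
    by (auto simp: max_A_paths_def)
  define q where "q = dropWhile is_A (rotate i es)"
  have ne: "rotate i es \<noteq> []" using i(1) by auto
  have pq: "rotate i es = p @ q" by (simp add: p q_def)
  have q: "q \<noteq> []" using i(3) ne last_in_set[OF ne] by (auto simp: q_def dropWhile_eq_Nil_conv)
  have "p \<noteq> []" using i(2) ne by (cases "rotate i es") (auto simp: p)
  moreover have "\<forall>e\<in>set p. is_A e" by (auto simp: p dest: set_takeWhileD)
  moreover have "\<not> is_A (hd q)" using hd_dropWhile q unfolding q_def by blast
  moreover have "\<not> is_A (last q)" using i(3) pq q by simp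
  ultimately show "p \<in> ?R" using pq q by blast
next
  fix p assume "p \<in> ?R"
  then obtain n q where h: "rotate n es = p @ q" "p \<noteq> []" "q \<noteq> []" "\<forall>e\<in>set p. is_A e"
    "\<not> is_A (hd q)" "\<not> is_A (last q)" by blast
  define i where "i = n mod length es"
  have ri: "rotate i es = p @ q" using h(1) rotate_conv_mod[of n es] by (simp add: i_def)
  have "es \<noteq> []" using h(1,2) by auto
  then have "i < length es" by (simp add: i_def)
  moreover have "is_A (hd (rotate i es))" using ri h(2,4) by simp
  moreover have "\<not> is_A (last (rotate i es))" using ri h(3,6) by simp
  moreover have "takeWhile is_A (rotate i es) = p"
    using h(3,4,5) by (cases q) (auto simp: ri takeWhile_append)
  ultimately show "p \<in> set (max_A_paths es)"
    unfolding max_A_paths_def by force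
qed

definition summary :: "'v edge list \<Rightarrow> 'v dl" where
  "summary p = DL (target (snd (last p))) (source (snd (hd p))) (path_weight p)"

definition dl_interpolant :: "'v edge list \<Rightarrow> 'v dl formula" where
  "dl_interpolant es =
     (if \<forall>e\<in>set es. is_A e then Bot else Conj (map summary (max_A_paths es)))"

definition interpolant :: "'v lin formula \<Rightarrow> 'v lin set \<Rightarrow> 'v lin set \<Rightarrow> bool" where
  "interpolant I A B \<longleftrightarrow>
     (\<forall>\<sigma> :: 'v \<Rightarrow> int. sat_all \<sigma> A \<longrightarrow> formula_holds \<sigma> I) \<and>
     (\<nexists>\<sigma> :: 'v \<Rightarrow> int. formula_holds \<sigma> I \<and> sat_all \<sigma> B) \<and>
     formula_vars I \<subseteq> vars_of A \<inter> vars_of B"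

end

(* For an integer assignment, let the slack of an edge be the value of the right-hand side of its
   constraint under the translation back. Slacks telescope along walks, so the slacks around a
   closed walk sum up to its weight, and the slack of a summary constraint is the sum of the slacks
   of the path. The weight of the path from x^- to x^+ is odd while its endpoints differ by the even
   number 2x, so integrality permits decreasing the weight by one. The shortened cycle has weight -1,
   hence its slacks cannot all be nonnegative; grouping them into maximal A'-paths and B'-edges gives
   the refutation. *)

theory Submission
  imports Defs
begin

section \<open>Slack of difference constraints and the encoding\<close>

definition potential :: "('v \<Rightarrow> int) \<Rightarrow> 'v dlvar \<Rightarrow> int" where
  "potential \<sigma> u = fst (ups_var u) * \<sigma> (snd (ups_var u))"

definition slack :: "('v \<Rightarrow> int) \<Rightarrow> 'v dl \<Rightarrow> int" where
  "slack \<sigma> d = potential \<sigma> (target d) - potential \<sigma> (source d) + weight d"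

lemma holds_ups_constr: "holds \<sigma> (ups_constr d) \<longleftrightarrow> 0 \<le> slack \<sigma> d"
  by (cases d) (simp add: slack_def potential_def)

text \<open>The coefficients are 1 or -1 and \<open>vars_lin\<close> performs no cancellation, so
  both variables occur even when they coincide.\<close>

lemma vars_ups_constr:
  "vars_lin (ups_constr d) = {snd (ups_var (target d)), snd (ups_var (source d))}"
proof -
  have "fst (ups_var v) \<noteq> 0" for v :: "'v dlvar"
    by (cases v) auto
  then show ?thesis
    by (cases d) auto
qed

text \<open>Since \<open>dlvar_of (negate s)\<close> translates to the negative of \<open>s\<close>,
  each edge from a two-variable constraint has slack equal to its right-hand side, and the edge from
  a one-variable constraint has twice that. \<open>utvpi\<close> ensures that \<open>occs\<close>
  drops no nonzero term.\<close>

lemma slack_encode_nonneg: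
  assumes "d \<in> encode c" and "utvpi c" and "holds \<sigma> c"
  shows "0 \<le> slack \<sigma> d"
  using assms by (cases c) (auto simp: occs_def slack_def potential_def split: if_splits)

lemma vars_encode:
  assumes "d \<in> encode c"
  shows "snd (ups_var (source d)) \<in> vars_lin c" "snd (ups_var (target d)) \<in> vars_lin c"
  using assms by (cases c; auto simp: occs_def split: if_splits)+

lemma slack_encode_all_nonneg:
  assumes "d \<in> encode_all S" and "\<forall>c\<in>S. utvpi c" and "sat_all \<sigma> S"
  shows "0 \<le> slack \<sigma> d"
  using assms slack_encode_nonneg by (fastforce simp: encode_all_def sat_all_def)

lemma vars_encode_all:
  assumes "d \<in> encode_all S"
  shows "snd (ups_var (source d)) \<in> vars_of S" "snd (ups_var (target d)) \<in> vars_of S"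
  using assms by (auto simp: encode_all_def vars_of_def intro: vars_encode)

section \<open>Closed walks, rotations and telescoping\<close>

lemma sum_list_map_rotate:
  fixes f :: "'a \<Rightarrow> 'b::comm_monoid_add"
  shows "sum_list (map f (rotate n xs)) = sum_list (map f xs)"
proof -
  have "sum_list (map f (rotate1 ys)) = sum_list (map f ys)" for ys
    by (cases ys) (simp_all add: add.commute)
  then show ?thesis
    by (induction n) simp_all
qed

lemma (in pre_digraph) cas_append:
  assumes "cas u p w" and "cas w q v"
  shows "cas u (p @ q) v"
  using assms by (induction p arbitrary: u) auto

text \<open>Rotating swaps the two pieces of the walk around a split point; the vertex there becomes
  the new base point.\<close>

lemma (in pre_digraph) cas_rotate:
  assumes "cas u p u"
  shows "\<exists>w. cas w (rotate n p) w"
proof -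
  let ?m = "n mod length p"
  have "cas u (take ?m p @ drop ?m p) u"
    using assms by simp
  then obtain w where "cas u (take ?m p) w" "cas w (drop ?m p) u"
    unfolding cas_append_iff by blast
  then have "cas w (drop ?m p @ take ?m p) w"
    by (rule cas_append[rotated])
  then show ?thesis
    unfolding rotate_drop_take by blast
qed

lemma (in pre_digraph) cas_endpoints:
  assumes "cas u p v" and "p \<noteq> []"
  shows "u = tail G (hd p)" "v = head G (last p)"
  using assms by (induction p arbitrary: u) auto

text \<open>The potentials telescope. Stated for \<open>cas\<close>, which does not ask the edges to
  belong to the graph, so that it covers the shortened cycle with its new edge.\<close>

lemma sum_slack_cas:
  assumes "pre_digraph.cas (constraint_graph A' B') u p v"
  shows "(\<Sum>e\<leftarrow>p. slack \<sigma> (snd e)) = potential \<sigma> v - potential \<sigma> u + path_weight p"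
  using assms
  by (induction p arbitrary: u)
    (auto simp: pre_digraph.cas.simps constraint_graph_def slack_def path_weight_def)

lemma cas_constraint_graph_ends:
  assumes "pre_digraph.cas (constraint_graph A' B') u p v" and "p \<noteq> []"
  shows "u = source (snd (hd p))" "v = target (snd (last p))"
  using pre_digraph.cas_endpoints[OF assms] by (simp_all add: constraint_graph_def)

section \<open>Maximal A-paths of a closed walk\<close>

lemma max_A_path_of_closed_cas:
  assumes cas: "pre_digraph.cas (constraint_graph A' B') u es u" and "p \<in> set (max_A_paths es)"
  obtains b c where "p \<noteq> []" "set p \<subseteq> set es" "\<forall>e\<in>set p. is_A e"
    "b \<in> set es" "\<not> is_A b" "source (snd (hd p)) = target (snd b)"
    "c \<in> set es" "\<not> is_A c" "target (snd (last p)) = source (snd c)"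
    "\<And>\<sigma>. slack \<sigma> (summary p) = (\<Sum>e\<leftarrow>p. slack \<sigma> (snd e))"
proof -
  obtain n q where pq: "rotate n es = p @ q" "p \<noteq> []" "q \<noteq> []" "\<forall>e\<in>set p. is_A e"
      "\<not> is_A (hd q)" "\<not> is_A (last q)"
    using assms(2) unfolding set_max_A_paths by blast
  obtain w where "pre_digraph.cas (constraint_graph A' B') w (p @ q) w"
    using pre_digraph.cas_rotate[OF cas, of n] pq(1) by auto
  then obtain w' where p: "pre_digraph.cas (constraint_graph A' B') w p w'"
    and q: "pre_digraph.cas (constraint_graph A' B') w' q w"
    unfolding pre_digraph.cas_append_iff by blast
  have set_es: "set es = set p \<union> set q"
    using arg_cong[OF pq(1), of set] by simp
  note ends = cas_constraint_graph_ends[OF p pq(2)] cas_constraint_graph_ends[OF q pq(3)]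
  have "slack \<sigma> (summary p) = (\<Sum>e\<leftarrow>p. slack \<sigma> (snd e))" for \<sigma>
    unfolding sum_slack_cas[OF p] using ends(1,2) by (simp add: summary_def slack_def)
  \<comment> \<open>Cyclically, \<open>last q\<close> enters the first vertex of \<open>p\<close>
    and \<open>hd q\<close> leaves its last one.\<close>
  then show ?thesis
    using pq set_es ends by (intro that[of "last q" "hd q"]) auto
qed

text \<open>Linear form of the grouping argument: repeatedly strip the leading run of A-edges and
  the B-edge after it. An empty \<open>xs\<close> counts as preceded by a B-edge because
  \<open>es\<close>, read cyclically, ends with one.\<close>

lemma sum_nonneg_of_max_A_segments:
  fixes f :: "'v edge \<Rightarrow> int"
  assumes "es = [] \<or> \<not> is_A (last es)"
    and "\<And>e. e \<in> set es \<Longrightarrow> \<not> is_A e \<Longrightarrow> 0 \<le> f e"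
    and "\<And>xs p ys. es = xs @ p @ ys \<Longrightarrow> p \<noteq> [] \<Longrightarrow> \<forall>e\<in>set p. is_A e \<Longrightarrow>
      xs = [] \<or> \<not> is_A (last xs) \<Longrightarrow> ys \<noteq> [] \<Longrightarrow> \<not> is_A (hd ys) \<Longrightarrow> 0 \<le> sum_list (map f p)"
  shows "0 \<le> sum_list (map f es)"
  using assms
proof (induction es rule: measure_induct_rule[of length])
  case (less es)
  note last_es = less.prems(1) and single = less.prems(2) and seg = less.prems(3)
  define p where "p = takeWhile is_A es"
  show ?case
  proof (cases "dropWhile is_A es")
    case Nil
    then have "\<forall>e\<in>set es. is_A e"
      by (simp add: dropWhile_eq_Nil_conv)
    then have "es = []"
      using last_es last_in_set by blast
    then show ?thesis
      by simp
  next
    case (Cons b ys)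
    have es: "es = p @ b # ys"
      by (metis Cons p_def takeWhile_dropWhile_id)
    have b: "\<not> is_A b"
      using hd_dropWhile[of is_A es] Cons by simp
    have "\<forall>e\<in>set p. is_A e"
      by (auto simp: p_def dest: set_takeWhileD)
    then have "0 \<le> sum_list (map f p)"
      using seg[of "[]" p "b # ys"] es b by (cases "p = []") auto
    moreover have "0 \<le> f b"
      using single es b by simp
    moreover have "0 \<le> sum_list (map f ys)"
    proof (rule less.IH)
      show "length ys < length es"
        using es by simp
      show "ys = [] \<or> \<not> is_A (last ys)"
        using last_es es by auto
      show "0 \<le> f e" if "e \<in> set ys" "\<not> is_A e" for e
        using single that es by simp
      show "0 \<le> sum_list (map f r)"
        if "ys = xs @ r @ zs" "r \<noteq> []" "\<forall>e\<in>set r. is_A e" "xs = [] \<or> \<not> is_A (last xs)"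
          "zs \<noteq> []" "\<not> is_A (hd zs)" for xs r zs
        \<comment> \<open>The enlarged prefix ends with \<open>b\<close> or with the last edge of
          \<open>xs\<close>, a B-edge in both cases, so maximality of \<open>r\<close> carries over
          to \<open>es\<close>.\<close>
        using seg[of "p @ b # xs" r zs] that es b by auto
    qed
    ultimately show ?thesis
      using es by simp
  qed
qed

lemma sum_nonneg_of_max_A_paths:
  fixes f :: "'v edge \<Rightarrow> int"
  assumes "\<exists>e\<in>set es. \<not> is_A e"
    and single: "\<And>e. e \<in> set es \<Longrightarrow> \<not> is_A e \<Longrightarrow> 0 \<le> f e"
    and path: "\<And>p. p \<in> set (max_A_paths es) \<Longrightarrow> 0 \<le> sum_list (map f p)"
  shows "0 \<le> sum_list (map f es)"
proof -
  obtain xs b ys where es: "es = xs @ b # ys" and b: "\<not> is_A b"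
    using assms(1) by (auto dest: split_list)
  \<comment> \<open>Cut just after the B-edge \<open>b\<close>, so that no maximal A-path wraps
    around the end of the list.\<close>
  let ?m = "Suc (length xs)"
  have rot: "rotate ?m es = ys @ xs @ [b]"
    using rotate_append[of "xs @ [b]" ys] es by simp
  have "0 \<le> sum_list (map f (rotate ?m es))"
  proof (rule sum_nonneg_of_max_A_segments)
    show "rotate ?m es = [] \<or> \<not> is_A (last (rotate ?m es))"
      unfolding rot using b by simp
    show "0 \<le> f e" if "e \<in> set (rotate ?m es)" "\<not> is_A e" for e
      using single that by simp
    show "0 \<le> sum_list (map f p)"
      if dec: "rotate ?m es = vs @ p @ ws" and p: "p \<noteq> []" "\<forall>e\<in>set p. is_A e"
        and vs: "vs = [] \<or> \<not> is_A (last vs)" and ws: "ws \<noteq> []" "\<not> is_A (hd ws)" for vs p ws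
    proof (rule path)
      \<comment> \<open>The cyclic predecessor of \<open>p\<close> is the last edge of
        \<open>ws @ vs\<close>; for empty \<open>vs\<close> this is the last edge of
        \<open>ws\<close>, namely \<open>b\<close>.\<close>
      have "last (vs @ p @ ws) = b"
        unfolding dec[symmetric] rot by simp
      then have "\<not> is_A (last (ws @ vs))"
        using vs ws(1) b by (cases "vs = []") auto
      moreover have "rotate (length vs + ?m) es = p @ (ws @ vs)"
        by (simp only: rotate_rotate[symmetric] dec rotate_append append_assoc)
      ultimately show "p \<in> set (max_A_paths es)"
        unfolding set_max_A_paths using p ws
        by (intro CollectI exI[of _ "length vs + ?m"] exI[of _ "ws @ vs"]) simp
    qed
  qed
  then show ?thesis
    by (simp only: sum_list_map_rotate)
qed

section \<open>The shortened cycle and its interpolant\<close>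

theorem mainTheorem10:
  fixes A B :: "'v lin set" and x :: 'v and k :: int and n :: nat
    and A' B' :: "'v dl set" and G :: "('v dlvar, 'v edge) pre_digraph" and u :: "'v dlvar"
    and C \<pi> \<rho> Cbar :: "'v edge list"
  assumes "finite A" and "finite B"
    and "\<forall>c\<in>A \<union> B. utvpi c"
    and "\<exists>\<sigma> :: 'v \<Rightarrow> rat. sat_all \<sigma> (A \<union> B)"
    and "\<nexists>\<sigma> :: 'v \<Rightarrow> int. sat_all \<sigma> (A \<union> B)"
    and "A' = encode_all A" and "B' = encode_all B"
    and "G = constraint_graph A' B'"
    and "C \<noteq> []" and "pre_digraph.awalk G u C u"
    and "path_weight C = 0"
    and "count_list (map (tail G) C) (Plus x) = 1"
    and "count_list (map (tail G) C) (Minus x) = 1"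
    and "rotate n C = \<pi> @ \<rho>"
    and "pre_digraph.awalk G (Minus x) \<pi> (Plus x)"
    and "path_weight \<pi> = 2 * k + 1"
    and "x \<in> vars_of A" and "x \<notin> vars_of B"
    and "\<forall>e\<in>set \<pi>. is_A e"
    and "Cbar = (LA, DL (Plus x) (Minus x) (2 * k)) # \<rho>"
  shows "interpolant (ups (dl_interpolant Cbar)) A B"
proof -
  define e0 where "e0 = (LA, DL (Plus x) (Minus x) (2 * k))"
  let ?cas = "pre_digraph.cas (constraint_graph A' B')"
  have Cbar: "Cbar = e0 # \<rho>"
    using assms(20) by (simp add: e0_def)
  have arcs_G: "arcs G = {LA} \<times> A' \<union> {LB} \<times> B'"
    using assms(8) by (simp add: constraint_graph_def)
  have set_C: "set C = set \<pi> \<union> set \<rho>"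
    using arg_cong[OF assms(14), of set] by simp
  have "set C \<subseteq> arcs G"
    using assms(10) by (simp add: pre_digraph.awalk_def)
  then have A_edge: "is_A e \<Longrightarrow> snd e \<in> A'" and B_edge: "\<not> is_A e \<Longrightarrow> snd e \<in> B'"
    if "e \<in> set C" for e
    using that unfolding arcs_G by auto

  have cas_\<pi>: "?cas (Minus x) \<pi> (Plus x)"
    using assms(8,15) by (simp add: pre_digraph.awalk_def)
  have "?cas u C u"
    using assms(8,10) by (simp add: pre_digraph.awalk_def)
  from pre_digraph.cas_rotate[OF this, of n]
  obtain w w' where w: "?cas w \<pi> w'" "?cas w' \<rho> w"
    unfolding assms(14) pre_digraph.cas_append_iff by blast
  \<comment> \<open>A nonempty walk determines its endpoints, which identifies \<open>w\<close> and
    \<open>w'\<close>.\<close>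
  have "\<pi> \<noteq> []"
    using cas_\<pi> by (auto simp: pre_digraph.cas.simps)
  then have "w = Minus x" "w' = Plus x"
    using cas_constraint_graph_ends[OF w(1)] cas_constraint_graph_ends[OF cas_\<pi>] by auto
  then have cas_Cbar: "?cas (Minus x) Cbar (Minus x)"
    using w(2) by (simp add: Cbar e0_def pre_digraph.cas.simps constraint_graph_def)
  have "path_weight \<pi> + path_weight \<rho> = path_weight (rotate n C)"
    unfolding assms(14) by (simp add: path_weight_def)
  also have "\<dots> = path_weight C"
    by (simp only: path_weight_def sum_list_map_rotate)
  finally have "path_weight Cbar = - 1"
    using assms(11,16) by (simp add: Cbar e0_def path_weight_def)
  then have sum_Cbar: "(\<Sum>e\<leftarrow>Cbar. slack \<sigma> (snd e)) = - 1" for \<sigma>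
    using sum_slack_cas[OF cas_Cbar] by simp

  have A_nonneg: "0 \<le> slack \<sigma> (snd e)" if \<sigma>: "sat_all \<sigma> A" and e: "e \<in> set Cbar" "is_A e" for \<sigma> e
  proof (cases "e = e0")
    case True
    have "0 \<le> slack \<sigma> (snd d)" if "d \<in> set \<pi>" for d
      using slack_encode_all_nonneg[of "snd d" A \<sigma>] A_edge[of d] that \<sigma> assms(3,6,19) set_C
      by auto
    then have "0 \<le> (\<Sum>e\<leftarrow>\<pi>. slack \<sigma> (snd e))"
      by (auto intro!: sum_list_nonneg)
    then have "0 \<le> 2 * \<sigma> x + 2 * k + 1"
      unfolding sum_slack_cas[OF cas_\<pi>] by (simp add: potential_def assms(16))
    \<comment> \<open>Integrality enters here: an even integer that is at least -1 is at least
      0.\<close>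
    then have "0 \<le> 2 * \<sigma> x + 2 * k"
      by presburger
    then show ?thesis
      by (simp add: True e0_def slack_def potential_def)
  next
    case False
    then show ?thesis
      using slack_encode_all_nonneg[of "snd e" A \<sigma>] A_edge[of e] e \<sigma> assms(3,6) set_C Cbar
      by auto
  qed

  show ?thesis
  proof (cases "\<forall>e\<in>set Cbar. is_A e")
    case True
    \<comment> \<open>The interpolant is \<open>Bot\<close>, so \<open>A\<close> alone has to be
      unsatisfiable over the integers.\<close>
    have "\<not> sat_all \<sigma> A" for \<sigma> :: "'v \<Rightarrow> int"
    proof
      assume "sat_all \<sigma> A"
      then have "0 \<le> (\<Sum>e\<leftarrow>Cbar. slack \<sigma> (snd e))"
        using A_nonneg True by (auto intro!: sum_list_nonneg)
      then show False
        unfolding sum_Cbar by simp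
    qed
    then show ?thesis
      using True by (simp add: interpolant_def dl_interpolant_def)
  next
    case False
    have I: "dl_interpolant Cbar = Conj (map summary (max_A_paths Cbar))"
      using False by (auto simp: dl_interpolant_def)
    have B_Cbar: "snd e \<in> B'" if "e \<in> set Cbar" "\<not> is_A e" for e
      using B_edge[of e] that set_C by (auto simp: Cbar e0_def)
    have "0 \<le> slack \<sigma> (summary p)" if "sat_all \<sigma> A" "p \<in> set (max_A_paths Cbar)" for \<sigma> p
      using that(2)
    proof (rule max_A_path_of_closed_cas[OF cas_Cbar])
      assume p: "set p \<subseteq> set Cbar" "\<forall>e\<in>set p. is_A e"
        and summary: "\<And>\<sigma>. slack \<sigma> (summary p) = (\<Sum>e\<leftarrow>p. slack \<sigma> (snd e))"
      have "0 \<le> slack \<sigma> (snd e)" if "e \<in> set p" for e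
        using A_nonneg[OF \<open>sat_all \<sigma> A\<close>, of e] p that by blast
      then show ?thesis
        unfolding summary by (auto intro!: sum_list_nonneg)
    qed
    then have entails: "formula_holds \<sigma> (ups (dl_interpolant Cbar))" if "sat_all \<sigma> A" for \<sigma>
      using that by (auto simp: I holds_ups_constr)
    \<comment> \<open>As \<open>\<sigma>\<close> need not satisfy \<open>A\<close>, single A-edges
      may have negative slack; only the totals over maximal A-paths are known to be
      nonnegative.\<close>
    have "\<not> sat_all \<sigma> B" if h: "formula_holds \<sigma> (ups (dl_interpolant Cbar))" for \<sigma>
    proof
      assume \<sigma>: "sat_all \<sigma> B"
      have "0 \<le> (\<Sum>e\<leftarrow>Cbar. slack \<sigma> (snd e))"
      proof (rule sum_nonneg_of_max_A_paths)
        show "\<exists>e\<in>set Cbar. \<not> is_A e"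
          using False by blast
        show "0 \<le> slack \<sigma> (snd e)" if "e \<in> set Cbar" "\<not> is_A e" for e
          using slack_encode_all_nonneg[of "snd e" B \<sigma>] B_Cbar[OF that] \<sigma> assms(3,7) by auto
        show "0 \<le> (\<Sum>e\<leftarrow>p. slack \<sigma> (snd e))" if p: "p \<in> set (max_A_paths Cbar)" for p
        proof -
          have "0 \<le> slack \<sigma> (summary p)"
            using h p by (auto simp: I holds_ups_constr)
          then show ?thesis
            using max_A_path_of_closed_cas[OF cas_Cbar p] by metis
        qed
      qed
      then show False
        unfolding sum_Cbar by simp
    qed
    moreover have "vars_lin (ups_constr (summary p)) \<subseteq> vars_of A \<inter> vars_of B"
      if p_max: "p \<in> set (max_A_paths Cbar)" for p
    proof -
      obtain b c where p: "p \<noteq> []" "set p \<subseteq> set Cbar" "\<forall>e\<in>set p. is_A e"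
        and b: "b \<in> set Cbar" "\<not> is_A b" "source (snd (hd p)) = target (snd b)"
        and c: "c \<in> set Cbar" "\<not> is_A c" "target (snd (last p)) = source (snd c)"
        by (rule max_A_path_of_closed_cas[OF cas_Cbar p_max]) blast
      \<comment> \<open>The new edge \<open>e0\<close> need not come from the encoding of
        \<open>A\<close>, but its only variable \<open>x\<close> occurs in \<open>A\<close> by
        assumption.\<close>
      have A_vars: "{snd (ups_var (source (snd e))), snd (ups_var (target (snd e)))} \<subseteq> vars_of A"
        if "e \<in> set p" for e
        using that p A_edge[of e] vars_encode_all[of "snd e" A] set_C assms(6,17)
        by (cases "e = e0") (auto simp: Cbar e0_def)
      \<comment> \<open>Both ends of the summary are also ends of the neighbouring B-edges
        \<open>b\<close> and \<open>c\<close>, so their variables occur in \<open>B\<close>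
        too.\<close>
      show ?thesis
        using A_vars[of "hd p"] A_vars[of "last p"] p(1) b(3) c(3)
          vars_encode_all[of "snd b" B] vars_encode_all[of "snd c" B]
          B_Cbar[OF b(1,2)] B_Cbar[OF c(1,2)] assms(7)
        by (auto simp: vars_ups_constr summary_def)
    qed
    ultimately show ?thesis
      using entails by (auto simp: interpolant_def I)
  qed
qed

end
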